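(* Let $\Omega\subset\mathbb H$ be a bounded axially symmetric s-domain and let $\mathbf i\in\mathbb S^2$. The sets of functions $\mathcal A_\rho(\Omega_{\mathbf i})$ and $\mathcal A(\Omega)$ contain the same elements and have equivalent norms. Similarly, $\mathcal A(\Omega_{\mathbf i})$ and $\mathcal A_\delta(\Omega)$ contain the same elements and have equivalent norms.
   Context: $\mathbb H$ is the algebra of real quaternions; $q\in\mathbb H$ is written $q=q_0+\underline q$ with $q_0$ real and $\underline q$ purely imaginary. $\mathbb S^2$ is the set of purely imaginary quaternions of modulus $1$, and for $\mathbf i\in\mathbb S^2$, $\mathbb C(\mathbf i)=\{x+y\mathbf i: x,y\in\mathbb R\}$, $\Omega_{\mathbf i}=\Omega\cap\mathbb C(\mathbf i)$. A domain $\Omega\subseteq\mathbb H$ is an s-domain if $\Omega\cap\mathbb R\neq\emptyset$ and $\Omega_{\mathbf i}$ is a domain in $\mathbb C(\mathbf i)$ for all $\mathbf i\in\mathbb S^2$. $\Omega$ is axially symmetric if $x+\mathbf i y\in\Omega$ implies $x+\mathbf j y\in\Omega$ for all $\mathbf j\in\mathbb S^2$. $\mathcal{SR}(\Omega)$ is the set of (left) slice regular functions on $\Omega$: real differentiable $f:\Omega\to\mathbb H$ such that for every $\mathbf i\in\mathbb S^2$, $\left(\frac{\partial}{\partial x}+\mathbf i\frac{\partial}{\partial y}\right)f|_{\Omega_{\mathbf i}}(x+y\mathbf i)=0$ on $\Omega_{\mathbf i}$. $d\mu$ is Lebesgue measure on $\mathbb H\cong\mathbb R^4$ and $d\sigma_{\mathbf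 i}(x+\mathbf i y)=dx\,dy$. Weights: $\rho(x+\mathbf i y)=y^2$ on $\Omega_{\mathbf i}$, and $\delta(q)=1/|\underline q|^2$ on $\Omega$ (defined almost everywhere). The four spaces consist of those $f\in\mathcal{SR}(\Omega)$ for which the following norms are finite: $\|f\|_{\mathcal A(\Omega)}=\left(\int_\Omega|f|^2d\mu\right)^{1/2}$; $\|f\|_{\mathcal A(\Omega_{\mathbf i})}=\left(\int_{\Omega_{\mathbf i}}|f|_{\Omega_{\mathbf i}}|^2d\sigma_{\mathbf i}\right)^{1/2}$; $\|f\|_{\mathcal A_\rho(\Omega_{\mathbf i})}=\left(\int_{\Omega_{\mathbf i}}|f|_{\Omega_{\mathbf i}}|^2\rho\,d\sigma_{\mathbf i}\right)^{1/2}$; $\|f\|_{\mathcal A_\delta(\Omega)}=\left(\int_\Omega|f|^2\delta\,d\mu\right)^{1/2}$. *)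

theory Defs
  imports "HOL-Analysis.Analysis"
begin

section \<open>Quaternions\<close>

text \<open>
  A quaternion is the pair (real part, imaginary part), the imaginary part being a vector of
  real 3-space.  Addition, real scaling, modulus, topology, derivative and Lebesgue measure are
  then those of the Euclidean space \<^typ>\<open>real \<times> (real ^ 3)\<close>.  The product is the scalar/vector
  form of Hamilton's: \<open>(a + u) (b + v) = (a b - u \<bullet> v) + (a v + b u + u \<times> v)\<close>.
\<close>

type_synonym quat = "real \<times> (real ^ 3)"

definition quat_of_real :: "real \<Rightarrow> quat"
  where "quat_of_real a = (a, 0)"

definition qmult :: "quat \<Rightarrow> quat \<Rightarrow> quat"  (infixl "*\<^sub>q" 70)
  where "p *\<^sub>q q =
    (fst p * fst q - snd p \<bullet> snd q,
     fst p *\<^sub>R snd q + fst q *\<^sub>R snd p + cross3 (snd p) (snd q))"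

lemma qmult_assoc: "p *\<^sub>q q *\<^sub>q r = p *\<^sub>q (q *\<^sub>q r)"
  by (simp add: qmult_def cross3_def vec_eq_iff forall_3 inner_vec_def sum_3 algebra_simps)

lemma qmult_of_real: "quat_of_real a *\<^sub>q p = a *\<^sub>R p" "p *\<^sub>q quat_of_real a = a *\<^sub>R p"
  by (simp_all add: qmult_def quat_of_real_def prod_eq_iff cross3_def vec_eq_iff forall_3)

lemma qmult_add: "p *\<^sub>q (q + r) = p *\<^sub>q q + p *\<^sub>q r" "(p + q) *\<^sub>q r = p *\<^sub>q r + q *\<^sub>q r"
  by (simp_all add: qmult_def cross3_def vec_eq_iff forall_3 inner_vec_def sum_3 algebra_simps)

lemma norm_qmult: "norm (p *\<^sub>q q) = norm p * norm q"
proof -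
  have "(norm (p *\<^sub>q q))\<^sup>2 = (norm p * norm q)\<^sup>2"
    unfolding power_mult_distrib power2_norm_eq_inner
    by (simp add: qmult_def inner_prod_def cross3_def inner_vec_def sum_3 algebra_simps
        power2_eq_square)
  then show ?thesis
    by (simp add: power2_eq_iff_nonneg)
qed

definition imag_units :: "quat set"
  where "imag_units = {q. fst q = 0 \<and> norm q = 1}"

lemma imag_unit_square: "i \<in> imag_units \<Longrightarrow> i *\<^sub>q i = quat_of_real (- 1)"
  by (auto simp: imag_units_def qmult_def quat_of_real_def norm_prod_def power2_norm_eq_inner)

text \<open>The point \<open>x + y i\<close> of the plane \<open>\<complex>(i)\<close>.\<close>

definition slice_point :: "quat \<Rightarrow> real \<Rightarrow> real \<Rightarrow> quat"
  where "slice_point i x y = quat_of_real x + y *\<^sub>R i"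

definition slice_plane :: "quat \<Rightarrow> quat set"
  where "slice_plane i = {slice_point i x y | x y. True}"


section \<open>Domains\<close>

definition domain_in :: "quat set \<Rightarrow> quat set \<Rightarrow> bool"
  where "domain_in X S \<longleftrightarrow> S \<noteq> {} \<and> openin (top_of_set X) S \<and> connected S"

definition s_domain :: "quat set \<Rightarrow> bool"
  where "s_domain \<Omega> \<longleftrightarrow>
    domain_in UNIV \<Omega> \<and>
    \<Omega> \<inter> range quat_of_real \<noteq> {} \<and>
    (\<forall>i\<in>imag_units. domain_in (slice_plane i) (\<Omega> \<inter> slice_plane i))"

definition axially_symmetric :: "quat set \<Rightarrow> bool"
  where "axially_symmetric \<Omega> \<longleftrightarrow>
    (\<forall>x y. \<forall>i\<in>imag_units. \<forall>j\<in>imag_units. slice_point i x y \<in> \<Omega> \<longrightarrow> slice_point j x y \<in> \<Omega>)"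


section \<open>Slice regular functions\<close>

text \<open>
  Functions on \<open>\<Omega>\<close> are rendered as extensional functions, so that two of them are equal exactly
  when they agree on \<open>\<Omega>\<close>.  For \<open>\<Omega>\<close> open and \<open>f\<close> differentiable on \<open>\<Omega>\<close>, both vector derivatives
  below exist and depend on \<open>f\<close> only through its values on \<open>\<Omega>\<close>.
\<close>

definition slice_regular :: "quat set \<Rightarrow> (quat \<Rightarrow> quat) set"
  where "slice_regular \<Omega> =
    {f \<in> extensional \<Omega>. f differentiable_on \<Omega> \<and>
      (\<forall>i\<in>imag_units. \<forall>x y. slice_point i x y \<in> \<Omega> \<longrightarrow>
        vector_derivative (\<lambda>s. f (slice_point i s y)) (at x)
        + i *\<^sub>q vector_derivative (\<lambda>t. f (slice_point i x t)) (at y) = 0)}"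


section \<open>Weighted Bergman spaces\<close>

text \<open>
  The slice of \<open>\<Omega>\<close> in the plane \<open>\<complex>(i)\<close>, in the coordinates \<open>(x, y)\<close>; the measure \<open>\<sigma>\<^sub>i\<close> is Lebesgue
  measure in these coordinates.  Finiteness of a norm is integrability of its (nonnegative,
  measurable) integrand.
\<close>

definition slice_coords :: "quat set \<Rightarrow> quat \<Rightarrow> (real \<times> real) set"
  where "slice_coords \<Omega> i = {(x, y). slice_point i x y \<in> \<Omega>}"

text \<open>At real points, which form a null set, this evaluates to 0 because \<open>1 / 0 = 0\<close>.\<close>

definition delta_weight :: "quat \<Rightarrow> real"
  where "delta_weight q = 1 / (norm (snd q))\<^sup>2"

definition bergman :: "quat set \<Rightarrow> (quat \<Rightarrow> quat) set"
  where "bergman \<Omega> =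
    {f \<in> slice_regular \<Omega>. set_integrable lebesgue \<Omega> (\<lambda>q. (norm (f q))\<^sup>2)}"

definition bergman_norm :: "quat set \<Rightarrow> (quat \<Rightarrow> quat) \<Rightarrow> real"
  where "bergman_norm \<Omega> f = sqrt (LINT q:\<Omega>|lebesgue. (norm (f q))\<^sup>2)"

definition bergman_delta :: "quat set \<Rightarrow> (quat \<Rightarrow> quat) set"
  where "bergman_delta \<Omega> =
    {f \<in> slice_regular \<Omega>. set_integrable lebesgue \<Omega> (\<lambda>q. (norm (f q))\<^sup>2 * delta_weight q)}"

definition bergman_delta_norm :: "quat set \<Rightarrow> (quat \<Rightarrow> quat) \<Rightarrow> real"
  where "bergman_delta_norm \<Omega> f =
    sqrt (LINT q:\<Omega>|lebesgue. (norm (f q))\<^sup>2 * delta_weight q)"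

definition bergman_slice :: "quat set \<Rightarrow> quat \<Rightarrow> (quat \<Rightarrow> quat) set"
  where "bergman_slice \<Omega> i =
    {f \<in> slice_regular \<Omega>.
      set_integrable lebesgue (slice_coords \<Omega> i) (\<lambda>(x, y). (norm (f (slice_point i x y)))\<^sup>2)}"

definition bergman_slice_norm :: "quat set \<Rightarrow> quat \<Rightarrow> (quat \<Rightarrow> quat) \<Rightarrow> real"
  where "bergman_slice_norm \<Omega> i f =
    sqrt (set_lebesgue_integral lebesgue (slice_coords \<Omega> i)
      (\<lambda>(x, y). (norm (f (slice_point i x y)))\<^sup>2))"

definition bergman_slice_rho :: "quat set \<Rightarrow> quat \<Rightarrow> (quat \<Rightarrow> quat) set"
  where "bergman_slice_rho \<Omega> i =
    {f \<in> slice_regular \<Omega>.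
      set_integrable lebesgue (slice_coords \<Omega> i)
        (\<lambda>(x, y). (norm (f (slice_point i x y)))\<^sup>2 * y\<^sup>2)}"

definition bergman_slice_rho_norm :: "quat set \<Rightarrow> quat \<Rightarrow> (quat \<Rightarrow> quat) \<Rightarrow> real"
  where "bergman_slice_rho_norm \<Omega> i f =
    sqrt (set_lebesgue_integral lebesgue (slice_coords \<Omega> i)
      (\<lambda>(x, y). (norm (f (slice_point i x y)))\<^sup>2 * y\<^sup>2))"

definition equivalent_norms_on :: "'a set \<Rightarrow> ('a \<Rightarrow> real) \<Rightarrow> ('a \<Rightarrow> real) \<Rightarrow> bool"
  where "equivalent_norms_on V N N' \<longleftrightarrow>
    (\<exists>c>0. \<exists>C>0. \<forall>f\<in>V. c * N f \<le> N' f \<and> N' f \<le> C * N f)"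

end

theory Submission
  imports Defs "HOL-Complex_Analysis.Complex_Analysis"
begin

text \<open>
  By the identity theorem, a slice regular \<open>f\<close> satisfies the representation formula
  \<open>2 f(x + j y) = (f(x + i y) + f(x - i y)) - j i (f(x + i y) - f(x - i y))\<close>.  The parallelogram law
  then makes \<open>|f(x + j y)|\<^sup>2 + |f(x - j y)|\<^sup>2\<close> independent of \<open>j\<close>.  The reflection \<open>q \<mapsto> Re q - Im q\<close>
  preserves Lebesgue measure, so \<open>|f|\<^sup>2\<close> may be replaced by its symmetrization, and polar coordinates in
  the imaginary 3-space give \<open>\<integral>\<^sub>\<Omega> |f|\<^sup>2 w(|Im q|) d\<mu> = 2 \<pi> \<integral> |f(x + i y)|\<^sup>2 w(|y|) y\<^sup>2 d\<sigma>\<^sub>i\<close>.  With \<open>w = 1\<close>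
  and \<open>w(r) = 1 / r\<^sup>2\<close>, both pairs of norms agree up to the factor \<open>\<surd>(2 \<pi>)\<close>.
\<close>

section \<open>Left multiplication and an identity theorem for quaternion-valued functions\<close>

lemma bounded_linear_qmult: "bounded_linear ((*\<^sub>q) p)"
proof -
  have "r *\<^sub>R (p *\<^sub>q q) = p *\<^sub>q (r *\<^sub>R q)" for r q
    by (metis qmult_assoc qmult_of_real)
  then show ?thesis
    by (simp add: linear_conv_bounded_linear[symmetric] linear_iff qmult_add)
qed

lemmas qmult_diff = linear_diff[OF bounded_linear.linear[OF bounded_linear_qmult]]
lemmas qmult_zero = linear_0[OF bounded_linear.linear[OF bounded_linear_qmult]]
lemmas qmult_minus = linear_neg[OF bounded_linear.linear[OF bounded_linear_qmult]]
lemmas qmult_scaleR = linear_scale[OF bounded_linear.linear[OF bounded_linear_qmult]]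

lemma imag_unit_qmult_twice: "i \<in> imag_units \<Longrightarrow> i *\<^sub>q (i *\<^sub>q p) = - p"
  by (simp add: qmult_assoc[symmetric] imag_unit_square qmult_of_real)

text \<open>The triple product is alternating, and as the real part of \<open>i\<close> vanishes the
  other terms change sign when \<open>p\<close> and \<open>q\<close> are exchanged. This
  skew-adjointness provides the Cauchy-Riemann equations in the identity theorem.\<close>

lemma inner_qmult_imag_unit:
  assumes "i \<in> imag_units"
  shows "(i *\<^sub>q p) \<bullet> q = - (p \<bullet> (i *\<^sub>q q))"
  using assms
  by (simp add: imag_units_def qmult_def inner_prod_def cross3_def inner_vec_def sum_3 algebra_simps)

lemma uminus_imag_unit: "i \<in> imag_units \<Longrightarrow> - i \<in> imag_units"
  by (simp add: imag_units_def)

lemma uminus_qmult: "(- p) *\<^sub>q q = - (p *\<^sub>q q)"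
  by (metis add_cancel_right_right eq_neg_iff_add_eq_0 qmult_add(2))

lemma slice_point_uminus: "slice_point (- i) x y = slice_point i x (- y)"
  by (simp add: slice_point_def)

text \<open>For every \<open>v\<close>, \<open>z \<mapsto> h z \<bullet> v + \<i> (h z \<bullet> j v)\<close> is holomorphic, so the identity theorem applies to each
  component of \<open>h\<close>.\<close>

lemma left_holomorphic_identity:
  fixes h :: "complex \<Rightarrow> quat"
  assumes S: "open S" "connected S" and j: "j \<in> imag_units"
    and h: "\<And>z. z \<in> S \<Longrightarrow>
      \<exists>p. (h has_derivative (\<lambda>w. Re w *\<^sub>R (- (j *\<^sub>q p)) + Im w *\<^sub>R p)) (at z)"
    and real: "complex_of_real a \<in> S"
    and zero: "\<And>x. complex_of_real x \<in> S \<Longrightarrow> h (of_real x) = 0"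
    and z: "z \<in> S"
  shows "h z = 0"
proof -
  have "h z \<bullet> v = 0" for v
  proof -
    define \<phi> where "\<phi> = (\<lambda>z. Complex (h z \<bullet> v) (h z \<bullet> (j *\<^sub>q v)))"
    have "\<phi> holomorphic_on S"
    proof (unfold holomorphic_on_def, intro ballI)
      fix z assume "z \<in> S"
      then obtain p where
        p: "(h has_derivative (\<lambda>w. Re w *\<^sub>R (- (j *\<^sub>q p)) + Im w *\<^sub>R p)) (at z)"
        using h by blast
      \<comment> \<open>The x-derivative of \<open>\<phi>\<close>: at \<open>w = 1\<close> the
        derivative of \<open>h\<close> is \<open>- (j *\<^sub>q p)\<close>, and skew-adjointness
        together with \<open>j\<close> squaring to -1 moves \<open>j\<close> off \<open>p\<close> in
        both components.\<close>
      define c where "c = Complex (p \<bullet> (j *\<^sub>q v)) (- (p \<bullet> v))"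
      have "(\<phi> has_derivative (\<lambda>w.
          Complex ((Re w *\<^sub>R (- (j *\<^sub>q p)) + Im w *\<^sub>R p) \<bullet> v)
            ((Re w *\<^sub>R (- (j *\<^sub>q p)) + Im w *\<^sub>R p) \<bullet> (j *\<^sub>q v)))) (at z)"
        unfolding \<phi>_def Complex_eq
        by (intro has_derivative_add has_derivative_mult_right has_derivative_of_real
            has_derivative_inner_left p)
      moreover have "Complex ((Re w *\<^sub>R (- (j *\<^sub>q p)) + Im w *\<^sub>R p) \<bullet> v)
            ((Re w *\<^sub>R (- (j *\<^sub>q p)) + Im w *\<^sub>R p) \<bullet> (j *\<^sub>q v)) = c * w" for w
        using j by (simp add: c_def complex_eq_iff inner_add_left inner_qmult_imag_unit
            imag_unit_qmult_twice algebra_simps)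
      ultimately have "(\<phi> has_field_derivative c) (at z)"
        by (simp add: has_field_derivative_def)
      then show "\<phi> field_differentiable at z within S"
        using field_differentiable_at_within field_differentiable_def by blast
    qed
    \<comment> \<open>As \<open>S\<close> is open, a single real point in it brings a whole real
      interval of zeros, hence a limit point of zeros.\<close>
    moreover have "complex_of_real a islimpt S \<inter> \<real>"
    proof (rule islimptI)
      fix T assume "complex_of_real a \<in> T" "open T"
      then have "open (S \<inter> T)" "complex_of_real a \<in> S \<inter> T"
        using S real by auto
      then obtain e where "e > 0" "ball (complex_of_real a) e \<subseteq> S \<inter> T"
        using open_contains_ball by blast
      moreover have "complex_of_real (a + e / 2) \<in> ball (complex_of_real a) e"
        using \<open>e > 0\<close> by (simp add: dist_norm del: of_real_add of_real_divide flip: of_real_diff)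
      ultimately show "\<exists>y\<in>S \<inter> \<real>. y \<in> T \<and> y \<noteq> complex_of_real a"
        by (intro bexI[of _ "complex_of_real (a + e / 2)"])
           (auto simp del: of_real_add of_real_divide)
    qed
    moreover have "\<phi> w = 0" if "w \<in> S \<inter> \<real>" for w
      using that zero by (auto simp: \<phi>_def Reals_def complex_eq_iff)
    ultimately have "\<phi> z = 0"
      using analytic_continuation[of \<phi> S "S \<inter> \<real>" "complex_of_real a" z] S real z by blast
    then show ?thesis
      by (simp add: \<phi>_def complex_eq_iff)
  qed
  from this[of "h z"] show ?thesis
    by simp
qed

section \<open>Slices as plane regions and the representation formula\<close>

text \<open>The same set as \<open>slice_coords\<close>, placed in the complex plane so that
  analytic continuation can be applied on it.\<close>

definition slice_region :: "quat set \<Rightarrow> quat \<Rightarrow> complex set"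
  where "slice_region \<Omega> i = {z. slice_point i (Re z) (Im z) \<in> \<Omega>}"

lemma bounded_linear_slice_point: "bounded_linear (\<lambda>z. slice_point i (Re z) (Im z))"
  by (simp add: linear_conv_bounded_linear[symmetric] linear_iff slice_point_def quat_of_real_def
      scaleR_add_left prod_eq_iff algebra_simps)

lemma open_slice_region:
  assumes "open \<Omega>"
  shows "open (slice_region \<Omega> i)"
  using open_vimage[OF assms, of "\<lambda>z. slice_point i (Re z) (Im z)"]
    bounded_linear.linear[OF bounded_linear_slice_point, of i]
  by (simp add: slice_region_def vimage_def linear_continuous_on linear_conv_bounded_linear)

text \<open>The region is the continuous image of the slice under the coordinate map; since
  \<open>snd i\<close> is a unit vector, the inner product with it recovers y.\<close>

lemma connected_slice_region:
  assumes i: "i \<in> imag_units" and con: "connected (\<Omega> \<inter> slice_plane i)"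
  shows "connected (slice_region \<Omega> i)"
proof -
  have "snd i \<bullet> snd i = 1"
    using i by (auto simp: imag_units_def norm_prod_def power2_norm_eq_inner[symmetric])
  then have *: "Complex (fst q) (snd q \<bullet> snd i) = z" if "q = slice_point i (Re z) (Im z)" for q z
    using i that by (simp add: slice_point_def quat_of_real_def complex_eq_iff imag_units_def)
  have "slice_region \<Omega> i = (\<lambda>q. Complex (fst q) (snd q \<bullet> snd i)) ` (\<Omega> \<inter> slice_plane i)"
  proof safe
    fix z assume "z \<in> slice_region \<Omega> i"
    then show "z \<in> (\<lambda>q. Complex (fst q) (snd q \<bullet> snd i)) ` (\<Omega> \<inter> slice_plane i)"
      using * by (intro image_eqI[of _ _ "slice_point i (Re z) (Im z)"])
        (auto simp: slice_region_def slice_plane_def)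
  next
    fix q assume "q \<in> \<Omega>" "q \<in> slice_plane i"
    then obtain x y where "q = slice_point i x y"
      by (auto simp: slice_plane_def)
    with \<open>q \<in> \<Omega>\<close> *[of q "Complex x y"]
    show "Complex (fst q) (snd q \<bullet> snd i) \<in> slice_region \<Omega> i"
      by (simp add: slice_region_def)
  qed
  moreover have "continuous_on (\<Omega> \<inter> slice_plane i) (\<lambda>q. Complex (fst q) (snd q \<bullet> snd i))"
    unfolding Complex_eq by (intro continuous_intros)
  ultimately show ?thesis
    using con by (simp add: connected_continuous_image)
qed

text \<open>By the chain rule the two vector derivatives in \<open>slice_regular\<close> are
  \<open>f' (quat_of_real 1)\<close> and \<open>f' k\<close>, so the regularity equation expresses
  the first through the second. The result is the hypothesis on \<open>h\<close> in
  \<open>left_holomorphic_identity\<close>, with \<open>p = f' k\<close>.\<close>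

lemma slice_regular_has_derivative:
  assumes f: "f \<in> slice_regular \<Omega>" and \<Omega>: "open \<Omega>" and k: "k \<in> imag_units"
    and z: "z \<in> slice_region \<Omega> k"
  shows "\<exists>p. ((\<lambda>w. f (slice_point k (Re w) (Im w))) has_derivative
      (\<lambda>w. Re w *\<^sub>R (- (k *\<^sub>q p)) + Im w *\<^sub>R p)) (at z)"
proof -
  define q where "q = slice_point k (Re z) (Im z)"
  have "q \<in> \<Omega>"
    using z by (simp add: q_def slice_region_def)
  moreover have "f differentiable_on \<Omega>"
    using f by (simp add: slice_regular_def)
  ultimately have "f differentiable (at q)"
    using \<Omega> by (metis at_within_open differentiable_on_def)
  then obtain f' where f': "(f has_derivative f') (at q)"
    by (auto simp: differentiable_def)
  then have lin: "linear f'"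
    by (simp add: has_derivative_linear)
  have "((\<lambda>s. f (slice_point k s (Im z))) has_derivative (\<lambda>s. f' (s *\<^sub>R quat_of_real 1))) (at (Re z))"
  proof (rule has_derivative_compose[of "\<lambda>s. slice_point k s (Im z)", OF _ f'[unfolded q_def]])
    have "slice_point k s (Im z) = s *\<^sub>R quat_of_real 1 + Im z *\<^sub>R k" for s
      by (simp add: slice_point_def quat_of_real_def)
    then show "((\<lambda>s. slice_point k s (Im z)) has_derivative (\<lambda>s. s *\<^sub>R quat_of_real 1)) (at (Re z))"
      by (auto intro!: derivative_eq_intros)
  qed
  then have dx: "vector_derivative (\<lambda>s. f (slice_point k s (Im z))) (at (Re z)) = f' (quat_of_real 1)"
    using lin by (intro vector_derivative_at) (simp add: has_vector_derivative_def linear_scale)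
  have "((\<lambda>t. f (slice_point k (Re z) t)) has_derivative (\<lambda>t. f' (t *\<^sub>R k))) (at (Im z))"
  proof (rule has_derivative_compose[of "\<lambda>t. slice_point k (Re z) t", OF _ f'[unfolded q_def]])
    show "((\<lambda>t. slice_point k (Re z) t) has_derivative (\<lambda>t. t *\<^sub>R k)) (at (Im z))"
      unfolding slice_point_def by (auto intro!: derivative_eq_intros)
  qed
  then have dy: "vector_derivative (\<lambda>t. f (slice_point k (Re z) t)) (at (Im z)) = f' k"
    using lin by (intro vector_derivative_at) (simp add: has_vector_derivative_def linear_scale)
  have "vector_derivative (\<lambda>s. f (slice_point k s (Im z))) (at (Re z))
      + k *\<^sub>q vector_derivative (\<lambda>t. f (slice_point k (Re z) t)) (at (Im z)) = 0"
    using f k \<open>q \<in> \<Omega>\<close> unfolding slice_regular_def q_def by blast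
  then have "f' (quat_of_real 1) + k *\<^sub>q f' k = 0"
    unfolding dx dy .
  then have 1: "f' (quat_of_real 1) = - (k *\<^sub>q f' k)"
    by (simp add: eq_neg_iff_add_eq_0)
  have "((\<lambda>w. f (slice_point k (Re w) (Im w))) has_derivative
      (\<lambda>w. f' (slice_point k (Re w) (Im w)))) (at z)"
    using has_derivative_compose[of "\<lambda>w. slice_point k (Re w) (Im w)", OF _ f'[unfolded q_def]]
      bounded_linear_imp_has_derivative[OF bounded_linear_slice_point] by blast
  moreover have "f' (slice_point k x y) = x *\<^sub>R (- (k *\<^sub>q f' k)) + y *\<^sub>R f' k" for x y
  proof -
    have "slice_point k x y = x *\<^sub>R quat_of_real 1 + y *\<^sub>R k"
      by (simp add: slice_point_def quat_of_real_def)
    then show ?thesis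
      using lin by (simp only: linear_add linear_scale 1)
  qed
  ultimately show ?thesis
    by (intro exI[of _ "f' k"]) simp
qed

lemma slice_region_axially_symmetric:
  assumes "axially_symmetric \<Omega>" "i \<in> imag_units" "j \<in> imag_units"
  shows "slice_region \<Omega> i = slice_region \<Omega> j"
  using assms unfolding slice_region_def axially_symmetric_def by blast

text \<open>As functions on the slice of \<open>j\<close>, both sides satisfy the Cauchy-Riemann
  equation for \<open>j\<close>. They agree at real points, where \<open>slice_point\<close> does
  not depend on the unit, so the identity theorem applies to their difference.\<close>

lemma representation_formula:
  assumes sym: "axially_symmetric \<Omega>" and dom: "s_domain \<Omega>" and f: "f \<in> slice_regular \<Omega>"
    and i: "i \<in> imag_units" and j: "j \<in> imag_units" and xy: "slice_point i x y \<in> \<Omega>"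
  shows "2 *\<^sub>R f (slice_point j x y) =
    (f (slice_point i x y) + f (slice_point i x (- y)))
    - j *\<^sub>q (i *\<^sub>q (f (slice_point i x y) - f (slice_point i x (- y))))"
proof -
  define S where "S = slice_region \<Omega> j"
  have S: "k \<in> imag_units \<Longrightarrow> S = slice_region \<Omega> k" for k
    unfolding S_def by (rule slice_region_axially_symmetric[OF sym j])
  have \<Omega>: "open \<Omega>"
    using dom by (simp add: s_domain_def domain_in_def)
  obtain a where a: "quat_of_real a \<in> \<Omega>"
    using dom by (auto simp: s_domain_def)
  define F where "F = (\<lambda>k w. f (slice_point k (Re w) (Im w)))"
  \<comment> \<open>The value at the conjugate point x - i y is written as \<open>F (- i)\<close>,
    so that it too is regular, with respect to the unit \<open>- i\<close>.\<close>
  define h where "h = (\<lambda>w. 2 *\<^sub>R F j w - (F i w + F (- i) w) + j *\<^sub>q (i *\<^sub>q (F i w - F (- i) w)))"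
  have D: "\<exists>p. (F k has_derivative (\<lambda>w. Re w *\<^sub>R (- (k *\<^sub>q p)) + Im w *\<^sub>R p)) (at z)"
    if "z \<in> S" "k \<in> imag_units" for k z
    using slice_regular_has_derivative[OF f \<Omega> that(2)] that S[OF that(2)] by (simp add: F_def)
  have "h (Complex x y) = 0"
  proof (rule left_holomorphic_identity[of S j h a])
    show "open S" "connected S"
      using \<Omega> dom j by (auto simp: S_def open_slice_region s_domain_def domain_in_def
          intro!: connected_slice_region)
    show "complex_of_real a \<in> S"
      using a by (simp add: S_def slice_region_def slice_point_def)
    show "h (complex_of_real x) = 0" for x
      by (simp add: h_def F_def slice_point_def qmult_zero scaleR_2)
    show "Complex x y \<in> S"
      using xy by (simp add: S[OF i] slice_region_def)
    show "j \<in> imag_units" by (fact j)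
    show "\<exists>p. (h has_derivative (\<lambda>w. Re w *\<^sub>R (- (j *\<^sub>q p)) + Im w *\<^sub>R p)) (at z)" if z: "z \<in> S" for z
    proof -
      obtain p where p: "(F i has_derivative (\<lambda>w. Re w *\<^sub>R (- (i *\<^sub>q p)) + Im w *\<^sub>R p)) (at z)"
        using D[OF z i] by blast
      obtain m where m: "(F (- i) has_derivative (\<lambda>w. Re w *\<^sub>R (i *\<^sub>q m) + Im w *\<^sub>R m)) (at z)"
        using D[OF z uminus_imag_unit[OF i]] by (auto simp: uminus_qmult)
      obtain r where r: "(F j has_derivative (\<lambda>w. Re w *\<^sub>R (- (j *\<^sub>q r)) + Im w *\<^sub>R r)) (at z)"
        using D[OF z j] by blast
      show ?thesis
      proof (rule exI, rule has_derivative_eq_rhs)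
        show "(h has_derivative (\<lambda>w. 2 *\<^sub>R (Re w *\<^sub>R (- (j *\<^sub>q r)) + Im w *\<^sub>R r)
          - ((Re w *\<^sub>R (- (i *\<^sub>q p)) + Im w *\<^sub>R p) + (Re w *\<^sub>R (i *\<^sub>q m) + Im w *\<^sub>R m))
          + j *\<^sub>q (i *\<^sub>q ((Re w *\<^sub>R (- (i *\<^sub>q p)) + Im w *\<^sub>R p)
              - (Re w *\<^sub>R (i *\<^sub>q m) + Im w *\<^sub>R m))))) (at z)"
          unfolding h_def
          by (intro has_derivative_add has_derivative_diff has_derivative_scaleR_right
              bounded_linear.has_derivative[OF bounded_linear_qmult] p m r)
        \<comment> \<open>The witness is the y-derivative of \<open>h\<close>, the coefficient of
          \<open>Im w\<close>. The x-derivatives of \<open>F i\<close> and \<open>F (- i)\<close>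
          carry opposite signs of \<open>i\<close>, so differentiating in x exchanges sums and
          differences; with \<open>i\<close> and \<open>j\<close> squaring to -1 the coefficient of
          \<open>Re w\<close> becomes \<open>- j\<close> times the witness.\<close>
        show "(\<lambda>w. 2 *\<^sub>R (Re w *\<^sub>R (- (j *\<^sub>q r)) + Im w *\<^sub>R r)
          - ((Re w *\<^sub>R (- (i *\<^sub>q p)) + Im w *\<^sub>R p) + (Re w *\<^sub>R (i *\<^sub>q m) + Im w *\<^sub>R m))
          + j *\<^sub>q (i *\<^sub>q ((Re w *\<^sub>R (- (i *\<^sub>q p)) + Im w *\<^sub>R p)
              - (Re w *\<^sub>R (i *\<^sub>q m) + Im w *\<^sub>R m)))) =
          (\<lambda>w. Re w *\<^sub>R (- (j *\<^sub>q (2 *\<^sub>R r - (p + m) + j *\<^sub>q (i *\<^sub>q (p - m)))))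
            + Im w *\<^sub>R (2 *\<^sub>R r - (p + m) + j *\<^sub>q (i *\<^sub>q (p - m))))"
          using i j by (simp add: fun_eq_iff qmult_add(1) qmult_diff qmult_scaleR qmult_minus
              imag_unit_qmult_twice scaleR_add_right scaleR_diff_right mult.commute)
      qed
    qed
  qed
  then show ?thesis
    by (simp add: h_def F_def slice_point_uminus algebra_simps)
qed

section \<open>Moduli at opposite points of a sphere\<close>

lemma norm_imag_unit: "i \<in> imag_units \<Longrightarrow> norm i = 1"
  by (simp add: imag_units_def)

lemma parallelogram_law:
  fixes a b :: "'a::real_inner"
  shows "(norm (a + b))\<^sup>2 + (norm (a - b))\<^sup>2 = 2 * ((norm a)\<^sup>2 + (norm b)\<^sup>2)"
  by (simp add: power2_norm_eq_inner algebra_simps inner_commute)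

text \<open>By the representation formula \<open>f (x \<plusminus> j y)\<close> are the sum and the difference of two quaternions
  whose moduli do not depend on \<open>j\<close>.\<close>

lemma slice_regular_norm_symmetrized:
  assumes sym: "axially_symmetric \<Omega>" and dom: "s_domain \<Omega>" and f: "f \<in> slice_regular \<Omega>"
    and i: "i \<in> imag_units" and j: "j \<in> imag_units" and xy: "slice_point i x y \<in> \<Omega>"
  shows "(norm (f (slice_point j x y)))\<^sup>2 + (norm (f (slice_point j x (- y))))\<^sup>2 =
    (norm (f (slice_point i x y)))\<^sup>2 + (norm (f (slice_point i x (- y))))\<^sup>2"
proof -
  define A where "A = f (slice_point i x y) + f (slice_point i x (- y))"
  define B where "B = f (slice_point i x y) - f (slice_point i x (- y))"
  have xy': "slice_point i x (- y) \<in> \<Omega>"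
    using sym xy i uminus_imag_unit[OF i] unfolding axially_symmetric_def
    by (metis slice_point_uminus)
  have 1: "2 *\<^sub>R f (slice_point j x y) = A - j *\<^sub>q (i *\<^sub>q B)"
    using representation_formula[OF sym dom f i j xy] by (simp add: A_def B_def)
  \<comment> \<open>Replacing y by - y fixes \<open>A\<close> and turns \<open>B\<close> into
    \<open>- B\<close>.\<close>
  have "2 *\<^sub>R f (slice_point j x (- y)) = A - j *\<^sub>q (i *\<^sub>q (- B))"
    using representation_formula[OF sym dom f i j xy'] by (simp add: A_def B_def add.commute)
  then have 2: "2 *\<^sub>R f (slice_point j x (- y)) = A + j *\<^sub>q (i *\<^sub>q B)"
    by (simp add: qmult_minus)
  have "4 * ((norm (f (slice_point j x y)))\<^sup>2 + (norm (f (slice_point j x (- y))))\<^sup>2) =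
      (norm (2 *\<^sub>R f (slice_point j x y)))\<^sup>2 + (norm (2 *\<^sub>R f (slice_point j x (- y))))\<^sup>2"
    by (simp add: power_mult_distrib)
  also have "\<dots> = 2 * ((norm A)\<^sup>2 + (norm (j *\<^sub>q (i *\<^sub>q B)))\<^sup>2)"
    unfolding 1 2 using parallelogram_law[of A "j *\<^sub>q (i *\<^sub>q B)"] by simp
  also have "\<dots> = 2 * ((norm A)\<^sup>2 + (norm B)\<^sup>2)"
    using i j by (simp add: norm_qmult norm_imag_unit)
  also have "\<dots> = 4 * ((norm (f (slice_point i x y)))\<^sup>2 + (norm (f (slice_point i x (- y))))\<^sup>2)"
    unfolding A_def B_def parallelogram_law by simp
  finally show ?thesis
    by simp
qed

section \<open>Polar coordinates and reflections for Lebesgue measure\<close>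

lemma emeasure_cball_real3:
  fixes c :: "real ^ 3"
  assumes "0 \<le> r"
  shows "emeasure lborel (cball c r) = ennreal (4 / 3 * pi * r ^ 3)"
  using assms by (simp add: emeasure_cball unit_ball_vol_3)

lemma nn_integral_radial_density:
  assumes "0 \<le> (r::real)"
  shows "(\<integral>\<^sup>+ s. ennreal (4 * pi * s\<^sup>2) * indicator {0..r} s \<partial>lborel) = ennreal (4 / 3 * pi * r ^ 3)"
proof -
  have "(\<integral>\<^sup>+ s. ennreal (4 * pi * s\<^sup>2) * indicator {0..r} s \<partial>lborel) =
      ennreal (4 / 3 * pi * r ^ 3 - 4 / 3 * pi * 0 ^ 3)"
    by (rule nn_integral_FTC_Icc) (use assms in \<open>auto intro!: derivative_eq_intros simp: power2_eq_square\<close>)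
  then show ?thesis
    by simp
qed

text \<open>Both measures give \<open>{..r}\<close> the volume of the ball of radius r, by
  integrating the sphere area on the right. Such half-lines are closed under intersection, generate
  the Borel sets, and exhaust the line with finite measure, so they determine the measure.\<close>

lemma distr_norm_lborel:
  "distr (lborel :: (real ^ 3) measure) borel norm =
    density lborel (\<lambda>r. ennreal (4 * pi * r\<^sup>2) * indicator {0..} r)" (is "?M = ?N")
proof (rule measure_eqI_generator_eq[where E = "range atMost" and \<Omega> = UNIV and A = "\<lambda>n. {..real n}"])
  show "Int_stable (range atMost :: real set set)"
    by (auto simp: Int_stable_def)
  show "sets ?M = sigma_sets UNIV (range atMost)" "sets ?N = sigma_sets UNIV (range atMost)"
    by (simp_all add: borel_eq_atMost)
  have M: "emeasure ?M {..r} = (if r < 0 then 0 else ennreal (4 / 3 * pi * r ^ 3))" for r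
  proof -
    have "norm -` {..r} = cball (0 :: real ^ 3) r"
      by auto
    then show ?thesis
      by (simp add: emeasure_distr emeasure_cball_real3)
  qed
  have N: "emeasure ?N {..r} = (if r < 0 then 0 else ennreal (4 / 3 * pi * r ^ 3))" for r
  proof -
    have "emeasure ?N {..r} = (\<integral>\<^sup>+ s. ennreal (4 * pi * s\<^sup>2) * indicator {0..r} s \<partial>lborel)"
      by (subst emeasure_density) (auto intro!: nn_integral_cong split: split_indicator)
    then show ?thesis
      by (simp add: nn_integral_radial_density)
  qed
  show "emeasure ?M X = emeasure ?N X" if "X \<in> range atMost" for X
    using that M N by auto
  show "emeasure ?M {..real n} \<noteq> \<infinity>" for n
    by (simp add: M)
  show "(\<Union>n. {..real n}) = UNIV"
    by (auto intro: real_arch_simple)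
qed auto

lemma nn_integral_norm_real3:
  assumes [measurable]: "g \<in> borel_measurable borel"
  shows "(\<integral>\<^sup>+ v. g (norm (v :: real ^ 3)) \<partial>lborel) =
    (\<integral>\<^sup>+ r. ennreal (4 * pi * r\<^sup>2) * indicator {0..} r * g r \<partial>lborel)"
proof -
  have "(\<integral>\<^sup>+ v. g (norm (v :: real ^ 3)) \<partial>lborel) =
      (\<integral>\<^sup>+ r. g r \<partial>distr (lborel :: (real ^ 3) measure) borel norm)"
    by (subst nn_integral_distr) auto
  then show ?thesis
    by (simp add: distr_norm_lborel nn_integral_density)
qed

lemma nn_integral_lborel_uminus:
  fixes f :: "'a::euclidean_space \<Rightarrow> ennreal"
  assumes [measurable]: "f \<in> borel_measurable borel"
  shows "(\<integral>\<^sup>+ v. f (- v) \<partial>lborel) = (\<integral>\<^sup>+ v. f v \<partial>lborel)"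
proof -
  have "(lborel :: 'a measure) = distr lborel borel uminus"
    \<comment> \<open>Scaling by -1 has Jacobian 1 in every dimension.\<close>
    using lborel_affine[of "-1" "0 :: 'a"] by (simp add: density_1)
  then have "(\<integral>\<^sup>+ v. f v \<partial>lborel) = (\<integral>\<^sup>+ v. f v \<partial>distr lborel borel uminus)"
    by simp
  also have "\<dots> = (\<integral>\<^sup>+ v. f (- v) \<partial>lborel)"
    by (subst nn_integral_distr) auto
  finally show ?thesis ..
qed

text \<open>Reflection carries the second summand to the negative half-line. This turns a polar
  integral over radii into an integral over the whole y-axis of a slice.\<close>

lemma nn_integral_lborel_fold:
  fixes g :: "real \<Rightarrow> ennreal"
  assumes [measurable]: "g \<in> borel_measurable borel"
  shows "(\<integral>\<^sup>+ r. indicator {0..} r * (g r + g (- r)) \<partial>lborel) = (\<integral>\<^sup>+ r. g r \<partial>lborel)"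
proof -
  have "(\<integral>\<^sup>+ r. indicator {0..} r * (g r + g (- r)) \<partial>lborel) =
      (\<integral>\<^sup>+ r. indicator {0..} r * g r \<partial>lborel) + (\<integral>\<^sup>+ r. indicator {0..} r * g (- r) \<partial>lborel)"
    by (simp add: distrib_left nn_integral_add)
  also have "(\<integral>\<^sup>+ r. indicator {0..} r * g (- r) \<partial>lborel) =
      (\<integral>\<^sup>+ r. indicator {0..} (- r) * g r \<partial>lborel)"
    using nn_integral_lborel_uminus[of "\<lambda>r::real. indicator {0..} (- r) * g r"] by simp
  also have "(\<integral>\<^sup>+ r. indicator {0..} r * g r \<partial>lborel) + \<dots> =
      (\<integral>\<^sup>+ r. indicator {0..} r * g r + indicator {0..} (- r) * g r \<partial>lborel)"
    by (simp add: nn_integral_add)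
  also have "\<dots> = (\<integral>\<^sup>+ r. g r \<partial>lborel)"
    \<comment> \<open>The two closed half-lines overlap only at 0, a null set.\<close>
    by (rule nn_integral_cong_AE, rule AE_mp[OF AE_lborel_singleton[of 0]])
       (auto split: split_indicator)
  finally show ?thesis .
qed

section \<open>Reduction of integrals over the quaternions to one slice\<close>

lemma slice_point_eq: "i \<in> imag_units \<Longrightarrow> slice_point i x y = (x, y *\<^sub>R snd i)"
  by (simp add: slice_point_def quat_of_real_def imag_units_def prod_eq_iff)

lemma measurable_slice_point:
  assumes "i \<in> imag_units"
  shows "(\<lambda>p. slice_point i (fst p) (snd p)) \<in> borel \<rightarrow>\<^sub>M borel"
  using assms
  by (intro borel_measurable_continuous_onI) (auto simp: slice_point_eq intro!: continuous_intros)

lemma borel_measurable_snd: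
  "(snd :: 'a::topological_space \<times> 'b::topological_space \<Rightarrow> 'b) \<in> borel \<rightarrow>\<^sub>M borel"
  by (intro borel_measurable_continuous_onI continuous_intros)

text \<open>For fixed real part x, adding the values at v and - v leaves a function of the norm of v
  alone, to which polar coordinates apply. The sphere contributes 4 pi and the symmetrization a
  factor 1/2; Fubini then integrates over x.\<close>

lemma nn_integral_quat_slice:
  fixes F :: "quat \<Rightarrow> ennreal"
  assumes [measurable]: "F \<in> borel_measurable borel" and i: "i \<in> imag_units"
    and sym: "\<And>j x y. j \<in> imag_units \<Longrightarrow>
      F (slice_point j x y) + F (slice_point j x (- y)) = F (slice_point i x y) + F (slice_point i x (- y))"
  shows "(\<integral>\<^sup>+ q. F q \<partial>lborel) =
    ennreal (2 * pi) * (\<integral>\<^sup>+ (x, y). F (slice_point i x y) * ennreal (y\<^sup>2) \<partial>lborel)"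
proof -
  \<comment> \<open>The symmetrized value on the sphere of radius r around x, read off on the slice
    of \<open>i\<close>.\<close>
  define H where "H = (\<lambda>x r. F (x, r *\<^sub>R snd i) + F (x, - r *\<^sub>R snd i))"
  have [measurable]: "H x \<in> borel_measurable borel" for x
    unfolding H_def by measurable
  have slice: "(\<integral>\<^sup>+ v. F (x, v) \<partial>lborel) =
      ennreal (2 * pi) * (\<integral>\<^sup>+ y. F (slice_point i x y) * ennreal (y\<^sup>2) \<partial>lborel)" for x
  proof -
    have H: "F (x, v) + F (x, - v) = H x (norm v)" for v
    proof (cases "v = 0")
      case False
      \<comment> \<open>The direction of v, so that (x, v) lies on the slice of \<open>j\<close> at
        height \<open>norm v\<close>.\<close>
      define j :: quat where "j = (0, v /\<^sub>R norm v)"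
      have j: "j \<in> imag_units"
        using False by (simp add: j_def imag_units_def norm_prod_def)
      show ?thesis
        using sym[OF j, of x "norm v"] i j False
        by (simp add: slice_point_eq H_def) (simp add: j_def)
    qed (simp add: H_def)
    \<comment> \<open>The integral is doubled to accommodate the reflected copy; the factor 2 is
      cancelled at the end.\<close>
    have "2 * (\<integral>\<^sup>+ v. F (x, v) \<partial>lborel) = (\<integral>\<^sup>+ v. F (x, v) \<partial>lborel) + (\<integral>\<^sup>+ v. F (x, - v) \<partial>lborel)"
      by (subst nn_integral_lborel_uminus[of "\<lambda>v. F (x, v)"]) (simp_all add: mult_2)
    also have "\<dots> = (\<integral>\<^sup>+ v. H x (norm (v :: real ^ 3)) \<partial>lborel)"
      by (simp add: nn_integral_add[symmetric] H)
    also have "\<dots> = (\<integral>\<^sup>+ r. ennreal (4 * pi * r\<^sup>2) * indicator {0..} r * H x r \<partial>lborel)"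
      by (rule nn_integral_norm_real3) simp
    \<comment> \<open>The square \<open>(- r)\<^sup>2\<close> is kept so that the integrand has the
      shape \<open>g r + g (- r)\<close> required for folding.\<close>
    also have "\<dots> = (\<integral>\<^sup>+ r. indicator {0..} r * (ennreal (4 * pi * r\<^sup>2) * F (slice_point i x r)
        + ennreal (4 * pi * (- r)\<^sup>2) * F (slice_point i x (- r))) \<partial>lborel)"
      using i by (intro nn_integral_cong) (simp add: H_def slice_point_eq algebra_simps)
    also have "\<dots> = (\<integral>\<^sup>+ r. ennreal (4 * pi * r\<^sup>2) * F (slice_point i x r) \<partial>lborel)"
      using i by (intro nn_integral_lborel_fold) (simp add: slice_point_eq)
    also have "\<dots> = (\<integral>\<^sup>+ r. 2 * (ennreal (2 * pi) * (F (slice_point i x r) * ennreal (r\<^sup>2))) \<partial>lborel)"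
    proof (intro nn_integral_cong)
      fix r :: real
      have "ennreal (4 * pi * r\<^sup>2) = 2 * (ennreal (2 * pi) * ennreal (r\<^sup>2))"
        by (simp add: ennreal_mult'[symmetric] flip: ennreal_numeral)
      then show "ennreal (4 * pi * r\<^sup>2) * F (slice_point i x r) =
          2 * (ennreal (2 * pi) * (F (slice_point i x r) * ennreal (r\<^sup>2)))"
        by (simp add: mult_ac)
    qed
    also have "\<dots> = 2 * (ennreal (2 * pi) * (\<integral>\<^sup>+ r. F (slice_point i x r) * ennreal (r\<^sup>2) \<partial>lborel))"
      using i by (simp add: nn_integral_cmult slice_point_eq)
    finally show ?thesis
      by (simp add: ennreal_mult_cancel_left)
  qed
  note [measurable] = measurable_slice_point[OF i] borel_measurable_snd
  have "(\<lambda>(x, y). F (slice_point i x y) * ennreal (y\<^sup>2)) \<in> borel_measurable borel"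
    unfolding case_prod_beta' by measurable
  then have G: "(\<lambda>(x, y). F (slice_point i x y) * ennreal (y\<^sup>2)) \<in> borel_measurable (lborel \<Otimes>\<^sub>M lborel)"
    by (simp add: lborel_prod)
  have F': "F \<in> borel_measurable (lborel \<Otimes>\<^sub>M lborel)"
    by (simp add: lborel_prod)
  have "(\<integral>\<^sup>+ q. F q \<partial>lborel) = (\<integral>\<^sup>+ x. \<integral>\<^sup>+ v. F (x, v) \<partial>lborel \<partial>lborel)"
    using lborel.nn_integral_fst[OF F'] by (simp add: lborel_prod)
  also have "\<dots> = ennreal (2 * pi) * (\<integral>\<^sup>+ x. \<integral>\<^sup>+ y. F (slice_point i x y) * ennreal (y\<^sup>2) \<partial>lborel \<partial>lborel)"
    using i by (simp add: slice nn_integral_cmult slice_point_eq)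
  also have "(\<integral>\<^sup>+ x. \<integral>\<^sup>+ y. F (slice_point i x y) * ennreal (y\<^sup>2) \<partial>lborel \<partial>lborel) =
      (\<integral>\<^sup>+ (x, y). F (slice_point i x y) * ennreal (y\<^sup>2) \<partial>lborel)"
    using lborel.nn_integral_fst[OF G] by (simp add: lborel_prod case_prod_beta')
  finally show ?thesis .
qed

text \<open>The factor 2 pi is finite and nonzero, so both extended integrals are finite together.
  Borel integrands have the same integrability and integral under \<open>lborel\<close> and under
  its completion \<open>lebesgue\<close>.\<close>

lemma lebesgue_integral_quat_slice:
  fixes F :: "quat \<Rightarrow> real"
  assumes F [measurable]: "F \<in> borel_measurable borel" and nonneg: "\<And>q. 0 \<le> F q"
    and i: "i \<in> imag_units"
    and sym: "\<And>j x y. j \<in> imag_units \<Longrightarrow>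
      F (slice_point j x y) + F (slice_point j x (- y)) = F (slice_point i x y) + F (slice_point i x (- y))"
  shows "integrable lebesgue F \<longleftrightarrow> integrable lebesgue (\<lambda>(x, y). F (slice_point i x y) * y\<^sup>2)" (is ?thesis1)
    and "integral\<^sup>L lebesgue F =
      2 * pi * integral\<^sup>L lebesgue (\<lambda>(x, y). F (slice_point i x y) * y\<^sup>2)" (is ?thesis2)
proof -
  define G where "G = (\<lambda>(x, y). F (slice_point i x y) * y\<^sup>2)"
  note [measurable] = measurable_slice_point[OF i] borel_measurable_snd
  have G: "G \<in> borel_measurable borel"
    unfolding G_def case_prod_beta' by measurable
  have G_nonneg: "0 \<le> G p" for p
    by (simp add: G_def nonneg case_prod_beta')
  have "(\<integral>\<^sup>+ q. ennreal (F q) \<partial>lborel) =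
      ennreal (2 * pi) * (\<integral>\<^sup>+ (x, y). ennreal (F (slice_point i x y)) * ennreal (y\<^sup>2) \<partial>lborel)"
  proof (rule nn_integral_quat_slice[OF _ i])
    show "ennreal (F (slice_point j x y)) + ennreal (F (slice_point j x (- y))) =
        ennreal (F (slice_point i x y)) + ennreal (F (slice_point i x (- y)))"
      if "j \<in> imag_units" for j x y
      using sym[OF that, of x y] nonneg by (metis ennreal_plus)
  qed simp
  then have eq: "(\<integral>\<^sup>+ q. ennreal (F q) \<partial>lborel) = ennreal (2 * pi) * (\<integral>\<^sup>+ p. ennreal (G p) \<partial>lborel)"
    by (simp add: G_def nonneg ennreal_mult case_prod_beta')
  have "ennreal (2 * pi) * I < \<infinity> \<longleftrightarrow> I < \<infinity>" for I
    by (auto simp: ennreal_mult_less_top)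
  then have "integrable lborel F \<longleftrightarrow> integrable lborel G"
    using F G eq nonneg G_nonneg by (simp add: integrable_iff_bounded)
  then show ?thesis1
    using F G by (simp add: integrable_completion flip: G_def)
  have "integral\<^sup>L lborel F = 2 * pi * integral\<^sup>L lborel G"
    using F G eq nonneg G_nonneg by (simp add: integral_eq_nn_integral enn2real_mult)
  then show ?thesis2
    using F G by (simp add: integral_completion flip: G_def)
qed

section \<open>Weighted integrals of slice regular functions\<close>

lemma slice_regular_borel_measurable:
  assumes dom: "s_domain \<Omega>" and f: "f \<in> slice_regular \<Omega>"
  shows "(\<lambda>q. indicator \<Omega> q *\<^sub>R (norm (f q))\<^sup>2) \<in> borel_measurable borel"
proof -
  have "open \<Omega>"
    using dom by (simp add: s_domain_def domain_in_def)
  moreover have "continuous_on \<Omega> f"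
    using f by (simp add: slice_regular_def differentiable_imp_continuous_on)
  ultimately show ?thesis
    by (intro borel_measurable_continuous_on_indicator continuous_intros) auto
qed

lemma norm_snd_imag_unit: "i \<in> imag_units \<Longrightarrow> norm (snd i) = 1"
  by (cases i) (auto simp: imag_units_def)

text \<open>The weight is constant on each sphere of fixed real part and fixed modulus of the
  imaginary part, so the symmetrized square modulus stays independent of the unit after weighting
  and after cutting off to \<Omega>.\<close>

lemma slice_regular_weighted_integral:
  fixes w :: "real \<Rightarrow> real"
  assumes sym: "axially_symmetric \<Omega>" and dom: "s_domain \<Omega>" and f: "f \<in> slice_regular \<Omega>"
    and i: "i \<in> imag_units"
    and w [measurable]: "w \<in> borel_measurable borel" and w_nonneg: "\<And>r. 0 \<le> w r"
  shows "set_integrable lebesgue \<Omega> (\<lambda>q. (norm (f q))\<^sup>2 * w (norm (snd q))) \<longleftrightarrow>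
      set_integrable lebesgue (slice_coords \<Omega> i)
        (\<lambda>(x, y). (norm (f (slice_point i x y)))\<^sup>2 * (w \<bar>y\<bar> * y\<^sup>2))" (is ?thesis1)
    and "(LINT q:\<Omega>|lebesgue. (norm (f q))\<^sup>2 * w (norm (snd q))) =
      2 * pi * set_lebesgue_integral lebesgue (slice_coords \<Omega> i)
        (\<lambda>(x, y). (norm (f (slice_point i x y)))\<^sup>2 * (w \<bar>y\<bar> * y\<^sup>2))" (is ?thesis2)
proof -
  define F where "F = (\<lambda>q. indicator \<Omega> q *\<^sub>R ((norm (f q))\<^sup>2 * w (norm (snd q))))"
  note [measurable] = slice_regular_borel_measurable[OF dom f] borel_measurable_snd
  have "(\<lambda>q. (indicator \<Omega> q *\<^sub>R (norm (f q))\<^sup>2) * w (norm (snd q))) \<in> borel_measurable borel"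
    by measurable
  then have F: "F \<in> borel_measurable borel"
    by (simp add: F_def mult.assoc)
  have norm_snd: "norm (snd (slice_point j x y)) = \<bar>y\<bar>" if "j \<in> imag_units" for j x y
    using that norm_snd_imag_unit[OF that] by (simp add: slice_point_eq)
  have F_sym: "F (slice_point j x y) + F (slice_point j x (- y)) =
      F (slice_point i x y) + F (slice_point i x (- y))" if j: "j \<in> imag_units" for j x y
  proof -
    \<comment> \<open>Axial symmetry puts all four points inside \<Omega> or all outside; in the
      latter case the indicator kills every term.\<close>
    have mem: "slice_point k x t \<in> \<Omega> \<longleftrightarrow> slice_point l x t \<in> \<Omega>"
      if "k \<in> imag_units" "l \<in> imag_units" for k l t
      using that sym unfolding axially_symmetric_def by blast
    have "slice_point i x (- y) \<in> \<Omega> \<longleftrightarrow> slice_point i x y \<in> \<Omega>"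
      using mem[OF uminus_imag_unit[OF i] i, of y] by (simp add: slice_point_uminus)
    with mem[OF i j, of y] mem[OF i j, of "- y"] show ?thesis
      using slice_regular_norm_symmetrized[OF sym dom f i j, of x y] i j
      by (cases "slice_point i x y \<in> \<Omega>") (simp_all add: F_def norm_snd flip: distrib_right)
  qed
  have G: "(\<lambda>(x, y). F (slice_point i x y) * y\<^sup>2) = (\<lambda>p. indicator (slice_coords \<Omega> i) p *\<^sub>R
      (case p of (x, y) \<Rightarrow> (norm (f (slice_point i x y)))\<^sup>2 * (w \<bar>y\<bar> * y\<^sup>2)))"
    using i by (auto simp: F_def slice_coords_def norm_snd fun_eq_iff split: split_indicator)
  have F_nonneg: "0 \<le> F q" for q
    using w_nonneg by (simp add: F_def)
  show ?thesis1 ?thesis2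
    using lebesgue_integral_quat_slice[where F = F, OF F F_nonneg i F_sym, unfolded G]
    unfolding set_integrable_def set_lebesgue_integral_def F_def by simp_all
qed

section \<open>The two equivalences of norms\<close>

lemma equivalent_norms_on_scaled:
  assumes "c > 0" "\<And>f. f \<in> V \<Longrightarrow> N' f = c * N f"
  shows "equivalent_norms_on V N N'"
  using assms by (auto simp: equivalent_norms_on_def intro!: exI[of _ c])

theorem corollary5p4:
  fixes \<Omega> :: "quat set" and i :: quat
  assumes "bounded \<Omega>" and "axially_symmetric \<Omega>" and "s_domain \<Omega>"
    and "i \<in> imag_units"
  shows "bergman_slice_rho \<Omega> i = bergman \<Omega>
      \<and> equivalent_norms_on (bergman \<Omega>) (bergman_slice_rho_norm \<Omega> i) (bergman_norm \<Omega>)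
      \<and> bergman_slice \<Omega> i = bergman_delta \<Omega>
      \<and> equivalent_norms_on (bergman_delta \<Omega>) (bergman_slice_norm \<Omega> i) (bergman_delta_norm \<Omega>)"
proof -
  note weighted = slice_regular_weighted_integral[OF assms(2,3) _ assms(4)]
  have rho: "set_integrable lebesgue \<Omega> (\<lambda>q. (norm (f q))\<^sup>2) \<longleftrightarrow>
      set_integrable lebesgue (slice_coords \<Omega> i) (\<lambda>(x, y). (norm (f (slice_point i x y)))\<^sup>2 * y\<^sup>2)"
    "bergman_norm \<Omega> f = sqrt (2 * pi) * bergman_slice_rho_norm \<Omega> i f"
    if "f \<in> slice_regular \<Omega>" for f
    using weighted[OF that, of "\<lambda>_. 1"]
    by (simp_all add: bergman_norm_def bergman_slice_rho_norm_def real_sqrt_mult)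
  \<comment> \<open>The product of the weight with the Jacobian factor is 1 for nonzero y but 0 at y
    = 0, because \<open>1 / 0 = 0\<close>. The integrands can therefore differ on the real
    axis.\<close>
  have eq_AE: "AE p in lebesgue. indicator (slice_coords \<Omega> i) p *\<^sub>R
        (case p of (x, y) \<Rightarrow> (norm (f (slice_point i x y)))\<^sup>2 * (1 / \<bar>y\<bar>\<^sup>2 * y\<^sup>2)) =
      indicator (slice_coords \<Omega> i) p *\<^sub>R (case p of (x, y) \<Rightarrow> (norm (f (slice_point i x y)))\<^sup>2)" for f
  proof (rule AE_I')
    \<comment> \<open>The axis y = 0 is the hyperplane orthogonal to (0, 1), hence null.\<close>
    show "{p. (0, 1) \<bullet> p = 0} \<in> null_sets (lebesgue :: (real \<times> real) measure)"
      using negligible_hyperplane[of "(0, 1) :: real \<times> real" 0]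
      by (simp add: negligible_iff_null_sets prod_eq_iff)
  qed (auto split: if_splits)
  have delta: "set_integrable lebesgue \<Omega> (\<lambda>q. (norm (f q))\<^sup>2 * delta_weight q) \<longleftrightarrow>
      set_integrable lebesgue (slice_coords \<Omega> i) (\<lambda>(x, y). (norm (f (slice_point i x y)))\<^sup>2)"
    "bergman_delta_norm \<Omega> f = sqrt (2 * pi) * bergman_slice_norm \<Omega> i f"
    if f: "f \<in> slice_regular \<Omega>" for f
  proof -
    let ?G = "\<lambda>p. indicator (slice_coords \<Omega> i) p *\<^sub>R
        (case p of (x, y) \<Rightarrow> (norm (f (slice_point i x y)))\<^sup>2 * (1 / \<bar>y\<bar>\<^sup>2 * y\<^sup>2))"
    let ?H = "\<lambda>p. indicator (slice_coords \<Omega> i) p *\<^sub>R (case p of (x, y) \<Rightarrow> (norm (f (slice_point i x y)))\<^sup>2)"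
    \<comment> \<open>\<open>delta_weight q\<close> is this weight evaluated at
      \<open>norm (snd q)\<close>.\<close>
    have w: "(\<lambda>r. 1 / r\<^sup>2) \<in> borel_measurable (borel :: real measure)" "\<And>r::real. 0 \<le> 1 / r\<^sup>2"
      by simp_all
    note [measurable] = borel_measurable_snd
    have H_eq: "?H = (\<lambda>p. indicator \<Omega> (slice_point i (fst p) (snd p)) *\<^sub>R
        (norm (f (slice_point i (fst p) (snd p))))\<^sup>2)"
      by (auto simp: slice_coords_def fun_eq_iff split: split_indicator)
    have H: "?H \<in> borel_measurable borel"
      unfolding H_eq
      by (rule measurable_compose[OF measurable_slice_point[OF assms(4)]
            slice_regular_borel_measurable[OF assms(3) f]])
    have G_eq: "?G = (\<lambda>p. ?H p * (1 / \<bar>snd p\<bar>\<^sup>2 * (snd p)\<^sup>2))"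
      by (simp add: case_prod_beta' mult.assoc)
    have G: "?G \<in> borel_measurable borel"
      unfolding G_eq using H by measurable
    have G': "?G \<in> borel_measurable lebesgue"
      by (rule measurable_completion) (use G in \<open>unfold measurable_lborel2\<close>)
    have H': "?H \<in> borel_measurable lebesgue"
      by (rule measurable_completion) (use H in \<open>unfold measurable_lborel2\<close>)
    have GH: "integrable lebesgue ?G \<longleftrightarrow> integrable lebesgue ?H" "integral\<^sup>L lebesgue ?G = integral\<^sup>L lebesgue ?H"
      using integrable_cong_AE[OF G' H' eq_AE[of f]] integral_cong_AE[OF G' H' eq_AE[of f]] .
    show "set_integrable lebesgue \<Omega> (\<lambda>q. (norm (f q))\<^sup>2 * delta_weight q) \<longleftrightarrow>
        set_integrable lebesgue (slice_coords \<Omega> i) (\<lambda>(x, y). (norm (f (slice_point i x y)))\<^sup>2)"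
      using weighted(1)[OF f w] GH(1) unfolding set_integrable_def delta_weight_def by simp
    show "bergman_delta_norm \<Omega> f = sqrt (2 * pi) * bergman_slice_norm \<Omega> i f"
      using weighted(2)[OF f w] GH(2)
      unfolding set_lebesgue_integral_def delta_weight_def bergman_delta_norm_def bergman_slice_norm_def
      by (simp add: real_sqrt_mult)
  qed
  show ?thesis
    using rho delta
    by (auto simp: bergman_def bergman_slice_rho_def bergman_delta_def bergman_slice_def
        intro!: equivalent_norms_on_scaled[of "sqrt (2 * pi)"])
qed

end
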